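(* Let $X \subseteq B^n$ be a sequence set whose set of prunable channels $p(X)$ is nonempty. Then $s(X) \ge H_{1+\max}\,\{\, s(X/i) \mid i \in p(X) \,\}_\#$, where the argument is a multiset (one entry for each $i\in p(X)$).
   Context: $B=\{0,1\}$, $[n]=\{1,\dots,n\}$. A comparator $[i,j]$ ($i\ne j\in[n]$) maps $x\in B^n$ to the sequence obtained by replacing $x_i$ by $\min(x_i,x_j)$ and $x_j$ by $\max(x_i,x_j)$; an exchange $(i,j)$ swaps entries $i$ and $j$. A comparator network on $n$ channels is a finite sequence of comparators and exchanges applied left to right; its size is its number of comparators. For $X\subseteq B^n$, a partial sorting network on $X$ is a comparator network whose output on every $x\in X$ is sorted (nondecreasing); $s(X)$ is the minimal size of a partial sorting network on $X$. For $x\in B^n$ and $i\in[n]$, $x/i\in B^{n-1}$ is $x$ with entry $i$ deleted; $X/i=\{x/i \mid x\in X,\ x_i=1\}$. The one-hot sequence $e^{(i,n)}\in B^n$ has entry $1$ at position $i$ and $0$ elsewhere; channel $i$ is prunable for $X$ if $e^{(i,n)}\in X$, and $p(X)$ is the set of prunable channels. For a nonempty finite multiset $L$ of nonnegative integers, $H_{1+\max} L$ is computed as follows: while the multiset has more than one element, remove two smallest elements $a,b$ and insert $1+\max(a,b)$; return the single remaining element. *)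

theory Defs
  imports Main "HOL-Library.Multiset"
begin

text \<open>
  Sequences over \<open>B = {0, 1}\<close> are boolean lists, with \<open>False\<close> for 0 and \<open>True\<close> for 1
  (in the library order \<open>False < True\<close>, so \<open>min\<close>, \<open>max\<close> and \<open>sorted\<close> have the intended
  meaning).  Channels are numbered \<open>0, \<dots>, n - 1\<close> instead of \<open>1, \<dots>, n\<close>.
\<close>

definition seqs :: "nat \<Rightarrow> bool list set" where
  "seqs n = {x. length x = n}"

datatype gate = Comparator nat nat | Exchange nat nat

fun apply_gate :: "gate \<Rightarrow> bool list \<Rightarrow> bool list" where
  "apply_gate (Comparator i j) x = x[i := min (x ! i) (x ! j), j := max (x ! i) (x ! j)]"
| "apply_gate (Exchange i j) x = x[i := x ! j, j := x ! i]"

fun valid_gate :: "nat \<Rightarrow> gate \<Rightarrow> bool" where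
  "valid_gate n (Comparator i j) \<longleftrightarrow> i < n \<and> j < n \<and> i \<noteq> j"
| "valid_gate n (Exchange i j) \<longleftrightarrow> i < n \<and> j < n \<and> i \<noteq> j"

fun is_comparator :: "gate \<Rightarrow> bool" where
  "is_comparator (Comparator i j) \<longleftrightarrow> True"
| "is_comparator (Exchange i j) \<longleftrightarrow> False"

type_synonym network = "gate list"

definition valid_network :: "nat \<Rightarrow> network \<Rightarrow> bool" where
  "valid_network n C \<longleftrightarrow> (\<forall>g \<in> set C. valid_gate n g)"

definition apply_network :: "network \<Rightarrow> bool list \<Rightarrow> bool list" where
  "apply_network C x = fold apply_gate C x"

definition network_size :: "network \<Rightarrow> nat" where
  "network_size C = length (filter is_comparator C)"

definition partial_sorting_network :: "nat \<Rightarrow> bool list set \<Rightarrow> network \<Rightarrow> bool" where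
  "partial_sorting_network n X C \<longleftrightarrow>
     valid_network n C \<and> (\<forall>x \<in> X. sorted (apply_network C x))"

definition min_size :: "nat \<Rightarrow> bool list set \<Rightarrow> nat" where
  "min_size n X = (LEAST m. \<exists>C. partial_sorting_network n X C \<and> network_size C = m)"

definition delete_entry :: "bool list \<Rightarrow> nat \<Rightarrow> bool list" where
  "delete_entry x i = take i x @ drop (Suc i) x"

definition prune :: "bool list set \<Rightarrow> nat \<Rightarrow> bool list set" where
  "prune X i = {delete_entry x i | x. x \<in> X \<and> x ! i = True}"

definition one_hot :: "nat \<Rightarrow> nat \<Rightarrow> bool list" where
  "one_hot i n = (replicate n False)[i := True]"

definition prunable_channels :: "nat \<Rightarrow> bool list set \<Rightarrow> nat set" where
  "prunable_channels n X = {i. i < n \<and> one_hot i n \<in> X}"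

text \<open>The value on the empty multiset is unspecified.\<close>

function huffman_max :: "nat multiset \<Rightarrow> nat" where
  "huffman_max L =
     (if size L \<le> 1 then the_elem (set_mset L)
      else let a = Min_mset L; L' = L - {#a#};
               b = Min_mset L'; L'' = L' - {#b#}
           in huffman_max (add_mset (1 + max a b) L''))"
  by pat_completeness auto

termination
proof (relation "measure size", goal_cases)
  case 1
  show ?case by simp
next
  case (2 L a L' b L'')
  have "a \<in># L"
    unfolding 2(2) using 2(1) by (intro Min_in) auto
  then have L': "size L = Suc (size L')"
    unfolding 2(3) by (rule size_Suc_Diff1[symmetric])
  with 2(1) have "L' \<noteq> {#}" by auto
  then have "b \<in># L'"
    unfolding 2(4) by (intro Min_in) auto
  then have "size L' = Suc (size L'')"
    unfolding 2(5) by (rule size_Suc_Diff1[symmetric])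
  with L' show ?case by simp
qed

declare huffman_max.simps [simp del]

end

theory Submission
  imports Defs "HOL-Combinatorics.Permutations"
begin

text \<open>
  Every input with a one on channel \<open>i\<close> has a one along the whole path that the single one of
  \<open>one_hot i n\<close> takes through a network \<open>C\<close>.  A comparator on this path only moves that one, so
  deleting the path removes all \<open>d i\<close> comparators on it and leaves a network for \<open>prune X i\<close>,
  whence \<open>min_size (n - 1) (prune X i) \<le> network_size C - d i\<close>.  For \<open>C\<close> sorting \<open>X\<close>, the paths
  from the prunable channels all end on the last channel, and two paths that meet merge in a
  comparator, so they form a binary tree and \<open>2 ^ - d i\<close> sums to at most 1 (Kraft).  On the
  other hand, \<open>huffman_max L \<le> m\<close> whenever the powers \<open>2 ^ s\<close> with \<open>s \<in># L\<close> sum to at most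
  \<open>2 ^ m\<close>.
\<close>

declare One_nat_def [simp del]

section \<open>Networks\<close>

lemma length_apply_gate [simp]: "length (apply_gate g x) = length x"
  by (cases g) auto

lemma apply_network_Nil [simp]: "apply_network [] x = x"
  by (simp add: apply_network_def)

lemma apply_network_Cons [simp]: "apply_network (g # C) x = apply_network C (apply_gate g x)"
  by (simp add: apply_network_def)

lemma apply_network_append [simp]:
  "apply_network (C @ D) x = apply_network D (apply_network C x)"
  by (simp add: apply_network_def)

lemma length_apply_network [simp]: "length (apply_network C x) = length x"
  by (induction C arbitrary: x) auto

lemma valid_network_Nil [simp]: "valid_network n []"
  by (simp add: valid_network_def)

lemma valid_network_Cons [simp]:
  "valid_network n (g # C) \<longleftrightarrow> valid_gate n g \<and> valid_network n C"
  by (simp add: valid_network_def)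

lemma valid_network_append [simp]:
  "valid_network n (C @ D) \<longleftrightarrow> valid_network n C \<and> valid_network n D"
  by (auto simp: valid_network_def)

lemma network_size_Nil [simp]: "network_size [] = 0"
  by (simp add: network_size_def)

lemma network_size_Cons [simp]:
  "network_size (g # C) = (if is_comparator g then 1 else 0) + network_size C"
  by (simp add: network_size_def)

lemma network_size_append [simp]: "network_size (C @ D) = network_size C + network_size D"
  by (simp add: network_size_def)

lemma valid_gate_mono: "valid_gate n g \<Longrightarrow> n \<le> m \<Longrightarrow> valid_gate m g"
  by (cases g) auto

lemma valid_network_mono: "valid_network n C \<Longrightarrow> n \<le> m \<Longrightarrow> valid_network m C"
  by (auto simp: valid_network_def intro: valid_gate_mono)

lemma apply_gate_snoc:
  "valid_gate (length x) g \<Longrightarrow> apply_gate g (x @ [t]) = apply_gate g x @ [t]"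
  by (cases g) (auto simp: list_update_append nth_append)

lemma apply_network_snoc:
  "valid_network (length x) C \<Longrightarrow> apply_network C (x @ [t]) = apply_network C x @ [t]"
  by (induction C arbitrary: x) (auto simp: apply_gate_snoc)


section \<open>Existence of sorting networks\<close>

text \<open>Comparators from channels \<open>0, ..., m - 1\<close> in turn into channel
  \<open>n\<close>: each leaves its own channel at most as large as channel \<open>n\<close>, which
  never decreases afterwards.\<close>

lemma max_network_exists:
  assumes "m \<le> n"
  shows "\<exists>C. valid_network (Suc n) C \<and>
    (\<forall>x. length x = Suc n \<longrightarrow> (\<forall>k<m. apply_network C x ! k \<le> apply_network C x ! n))"
  using assms
proof (induction m)
  case 0
  show ?case by (intro exI[of _ "[]"]) simp
next
  case (Suc m)
  then obtain C where C: "valid_network (Suc n) C"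
    "\<And>x k. length x = Suc n \<Longrightarrow> k < m \<Longrightarrow> apply_network C x ! k \<le> apply_network C x ! n"
    by (meson Suc_leD)
  have "apply_network (C @ [Comparator m n]) x ! k \<le> apply_network (C @ [Comparator m n]) x ! n"
    if "length x = Suc n" "k < Suc m" for x k
    using C(2)[OF that(1), of k] Suc.prems that
    by (auto simp: nth_list_update less_Suc_eq min_def max_def)
  then show ?case
    using C(1) Suc.prems by (intro exI[of _ "C @ [Comparator m n]"]) auto
qed

text \<open>Selection sort: bring the maximum to the last channel, then sort the others. This makes
  the \<open>LEAST\<close> in \<open>min_size\<close> an attained minimum.\<close>

lemma sorting_network_exists: "\<exists>C. partial_sorting_network n (seqs n) C"
proof (induction n)
  case 0
  show ?case by (intro exI[of _ "[]"]) (simp add: partial_sorting_network_def seqs_def)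
next
  case (Suc n)
  then obtain D where D: "valid_network n D" "\<And>x. length x = n \<Longrightarrow> sorted (apply_network D x)"
    by (auto simp: partial_sorting_network_def seqs_def)
  obtain C where C: "valid_network (Suc n) C"
    "\<And>x k. length x = Suc n \<Longrightarrow> k < n \<Longrightarrow> apply_network C x ! k \<le> apply_network C x ! n"
    using max_network_exists[of n n] by auto
  \<comment> \<open>Gates only rearrange values, so \<open>D\<close> cannot create an entry above
    the last one.\<close>
  have set_sub: "set (apply_network E y) \<subseteq> set y" if "valid_network (length y) E" for E y
    using that
  proof (induction E arbitrary: y)
    case (Cons g E)
    have "set (apply_gate g y) \<subseteq> set y"
      using Cons.prems
      by (cases g) (auto simp: in_set_conv_nth nth_list_update min_def max_def split: if_splits)
    then show ?case using Cons.IH[of "apply_gate g y"] Cons.prems by auto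
  qed simp
  have "sorted (apply_network (C @ D) x)" if x: "length x = Suc n" for x
  proof -
    define y where "y = apply_network C x"
    obtain z t where y: "y = z @ [t]" "length z = n"
      using x by (metis y_def length_apply_network length_Suc_conv_rev)
    have "\<forall>u\<in>set z. u \<le> t"
      using C(2)[OF x] y by (force simp: in_set_conv_nth nth_append y_def[symmetric])
    then have "\<forall>u\<in>set (apply_network D z). u \<le> t"
      using set_sub[of z D] D(1) y by blast
    then show ?thesis
      using D(1) D(2)[of z] y by (auto simp: y_def[symmetric] apply_network_snoc sorted_append)
  qed
  then show ?case
    using C(1) D(1)
    by (intro exI[of _ "C @ D"])
      (auto simp: partial_sorting_network_def seqs_def intro: valid_network_mono)
qed

lemma min_size_attained:
  assumes "X \<subseteq> seqs n"
  obtains C where "partial_sorting_network n X C" "network_size C = min_size n X"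
proof -
  have "\<exists>m C. partial_sorting_network n X C \<and> network_size C = m"
    using sorting_network_exists[of n] assms by (auto simp: partial_sorting_network_def)
  from LeastI_ex[OF this] show ?thesis
    using that by (auto simp: min_size_def)
qed

lemma min_size_le: "partial_sorting_network n X C \<Longrightarrow> min_size n X \<le> network_size C"
  unfolding min_size_def by (rule Least_le) auto


section \<open>Deleting a channel\<close>

text \<open>Enumerates the channels other than \<open>p\<close> in order, so it locates in
  \<open>x\<close> the entries of \<open>delete_entry x p\<close>; \<open>remove_channel p\<close>
  is its inverse.\<close>

definition insert_channel :: "nat \<Rightarrow> nat \<Rightarrow> nat" where
  "insert_channel p k = (if k < p then k else Suc k)"

definition remove_channel :: "nat \<Rightarrow> nat \<Rightarrow> nat" where
  "remove_channel p k = (if k < p then k else k - 1)"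

lemma insert_remove_channel [simp]: "k \<noteq> p \<Longrightarrow> insert_channel p (remove_channel p k) = k"
  by (auto simp: insert_channel_def remove_channel_def)

lemma insert_channel_neq [simp]: "insert_channel p k \<noteq> p"
  by (auto simp: insert_channel_def)

lemma insert_channel_eq_iff [simp]: "insert_channel p k = insert_channel p l \<longleftrightarrow> k = l"
  by (auto simp: insert_channel_def)

lemma insert_channel_less: "k < n - 1 \<Longrightarrow> insert_channel p k < n"
  by (auto simp: insert_channel_def)

lemma remove_channel_eq_iff:
  "k \<noteq> p \<Longrightarrow> l \<noteq> p \<Longrightarrow> remove_channel p k = remove_channel p l \<longleftrightarrow> k = l"
  by (auto simp: remove_channel_def)

lemma remove_channel_less: "k < n \<Longrightarrow> p < n \<Longrightarrow> k \<noteq> p \<Longrightarrow> remove_channel p k < n - 1"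
  by (auto simp: remove_channel_def)

lemma length_delete_entry [simp]: "p < length x \<Longrightarrow> length (delete_entry x p) = length x - 1"
  by (simp add: delete_entry_def)

lemma nth_delete_entry:
  "p < length x \<Longrightarrow> k < length x - 1 \<Longrightarrow> delete_entry x p ! k = x ! insert_channel p k"
  by (auto simp: delete_entry_def insert_channel_def nth_append)

lemma nth_remove_channel:
  assumes "p < length x" "k < length x" "k \<noteq> p"
  shows "delete_entry x p ! remove_channel p k = x ! k"
  using assms by (simp add: nth_delete_entry remove_channel_less)

lemma delete_entry_update:
  assumes "p < length x" "k < length x" "k \<noteq> p"
  shows "delete_entry (x[k := u]) p = (delete_entry x p)[remove_channel p k := u]"
proof (rule nth_equalityI)
  fix l assume "l < length (delete_entry (x[k := u]) p)"
  then have l: "l < length x - 1" using assms by simp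
  have "k = insert_channel p l \<longleftrightarrow> remove_channel p k = l"
    using assms(3) by (metis insert_channel_eq_iff insert_remove_channel)
  then show "delete_entry (x[k := u]) p ! l = (delete_entry x p)[remove_channel p k := u] ! l"
    using assms l by (auto simp: nth_delete_entry nth_list_update insert_channel_less)
qed (use assms in simp)

lemma sorted_delete_entry: "sorted x \<Longrightarrow> sorted (delete_entry x p)"
proof -
  assume "sorted x"
  then have "sorted (take p x @ drop p x)" by simp
  then have "\<forall>u\<in>set (take p x). \<forall>v\<in>set (drop p x). u \<le> v"
    unfolding sorted_append by blast
  moreover have "set (drop (Suc p) x) \<subseteq> set (drop p x)"
    by (simp add: set_drop_subset_set_drop)
  ultimately show ?thesis
    using \<open>sorted x\<close> unfolding delete_entry_def sorted_append
    by (auto simp: sorted_wrt_take sorted_wrt_drop)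
qed

text \<open>Transpositions generate all permutations, and each is a single exchange, which is free.
  The exchange goes in front because \<open>D\<close> then reads position \<open>\<pi> k\<close> of
  the swapped input.\<close>

lemma permutation_network_exists:
  assumes "\<pi> permutes {..<m}"
  shows "\<exists>D. valid_network m D \<and> network_size D = 0 \<and>
    (\<forall>y k. length y = m \<longrightarrow> k < m \<longrightarrow> apply_network D y ! k = y ! \<pi> k)"
  using assms finite_lessThan[of m]
proof (induction rule: permutes_induct)
  case id
  show ?case by (intro exI[of _ "[]"]) simp
next
  case (swap a b \<pi>)
  then obtain D where D: "valid_network m D" "network_size D = 0"
    "\<And>y k. length y = m \<Longrightarrow> k < m \<Longrightarrow> apply_network D y ! k = y ! \<pi> k" by blast
  show ?case
  proof (cases "a = b")
    case True
    then show ?thesis using D by auto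
  next
    case False
    have "apply_network (Exchange a b # D) y ! k = y ! (transpose a b \<circ> \<pi>) k"
      if "length y = m" "k < m" for y k
    proof -
      have "\<pi> k < m" using permutes_in_image[OF swap.hyps(4), of k] that by simp
      then show ?thesis
        using D(3)[of "apply_gate (Exchange a b) y" k] swap.hyps(1,2) that
        by (auto simp: nth_list_update transpose_def)
    qed
    then show ?thesis
      using D(1,2) False swap.hyps by (intro exI[of _ "Exchange a b # D"]) auto
  qed
qed

text \<open>The two deletions leave the same entries in possibly different order: if
  \<open>p\<close> is \<open>i\<close> or \<open>j\<close>, the entries between these channels are
  rotated. Exchanges repair this at no cost.\<close>

lemma delete_entry_exchange:
  assumes ij: "i < n" "j < n" "i \<noteq> j" and p: "p < n"
  shows "\<exists>D. valid_network (n - 1) D \<and> network_size D = 0 \<and>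
    (\<forall>x. length x = n \<longrightarrow> apply_network D (delete_entry x p) =
      delete_entry (apply_gate (Exchange i j) x) (transpose i j p))"
proof -
  let ?\<tau> = "transpose i j"
  \<comment> \<open>Traces output position \<open>k\<close> back: to its channel after the exchange,
    through the exchange, then to its place once \<open>p\<close> is deleted. Being the identity
    from \<open>n - 1\<close> on is what \<open>permutes\<close> demands.\<close>
  define \<pi> where
    "\<pi> k = (if k < n - 1 then remove_channel p (?\<tau> (insert_channel (?\<tau> p) k)) else k)" for k
  have neq: "?\<tau> (insert_channel (?\<tau> p) k) \<noteq> p" for k
    by (metis insert_channel_neq transpose_involutory)
  have less: "?\<tau> (insert_channel (?\<tau> p) k) < n" if "k < n - 1" for k
    using insert_channel_less[OF that] ij by (auto simp: transpose_def)
  have "inj_on \<pi> {..<n - 1}"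
    by (auto intro!: inj_onI simp: \<pi>_def remove_channel_eq_iff neq dest!: transpose_eq_imp_eq)
  moreover have "\<pi> ` {..<n - 1} \<subseteq> {..<n - 1}"
    using less neq p by (auto simp: \<pi>_def intro!: remove_channel_less)
  ultimately have "bij_betw \<pi> {..<n - 1} {..<n - 1}"
    by (simp add: bij_betw_def endo_inj_surj)
  then have "\<pi> permutes {..<n - 1}"
    by (rule bij_imp_permutes) (simp add: \<pi>_def)
  then obtain D where D: "valid_network (n - 1) D" "network_size D = 0"
    "\<And>y k. length y = n - 1 \<Longrightarrow> k < n - 1 \<Longrightarrow> apply_network D y ! k = y ! \<pi> k"
    using permutation_network_exists by blast
  have p': "?\<tau> p < n" using ij p by (auto simp: transpose_def)
  have "apply_network D (delete_entry x p) = delete_entry (apply_gate (Exchange i j) x) (?\<tau> p)"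
    if x: "length x = n" for x
  proof (rule nth_equalityI)
    fix k assume "k < length (apply_network D (delete_entry x p))"
    then have k: "k < n - 1" using p x by simp
    have "apply_network D (delete_entry x p) ! k = delete_entry x p ! \<pi> k"
      using D(3) k p x by simp
    also have "\<dots> = x ! ?\<tau> (insert_channel (?\<tau> p) k)"
      using k p x by (simp add: \<pi>_def nth_remove_channel less neq)
    also have "\<dots> = apply_gate (Exchange i j) x ! insert_channel (?\<tau> p) k"
      using ij x insert_channel_less[OF k] by (auto simp: nth_list_update transpose_def)
    also have "\<dots> = delete_entry (apply_gate (Exchange i j) x) (?\<tau> p) ! k"
      using k p' x by (simp add: nth_delete_entry)
    finally show "apply_network D (delete_entry x p) ! k =
      delete_entry (apply_gate (Exchange i j) x) (?\<tau> p) ! k" .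
  qed (use p p' x in simp)
  with D show ?thesis by blast
qed


section \<open>Following a one through a network\<close>

text \<open>A one on channel \<open>i\<close> of a comparator forces a one on \<open>j\<close>, and
  a one on \<open>j\<close> stays there, whatever the other input is. So the path depends only on
  its starting channel.\<close>

fun move_one :: "gate \<Rightarrow> nat \<Rightarrow> nat" where
  "move_one (Comparator i j) p = (if p = i then j else p)"
| "move_one (Exchange i j) p = transpose i j p"

fun touches :: "gate \<Rightarrow> nat \<Rightarrow> bool" where
  "touches (Comparator i j) p \<longleftrightarrow> p = i \<or> p = j"
| "touches (Exchange i j) p \<longleftrightarrow> False"

fun final_channel :: "network \<Rightarrow> nat \<Rightarrow> nat" where
  "final_channel [] p = p"
| "final_channel (g # C) p = final_channel C (move_one g p)"

fun path_comparators :: "network \<Rightarrow> nat \<Rightarrow> nat" where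
  "path_comparators [] p = 0"
| "path_comparators (g # C) p = (if touches g p then 1 else 0) + path_comparators C (move_one g p)"

lemma move_one_less: "valid_gate n g \<Longrightarrow> p < n \<Longrightarrow> move_one g p < n"
  by (cases g) (auto simp: transpose_def)

lemma apply_gate_move_one:
  "valid_gate (length x) g \<Longrightarrow> p < length x \<Longrightarrow> x ! p \<Longrightarrow> apply_gate g x ! move_one g p"
  by (cases g) (auto simp: transpose_def nth_list_update max_def)

lemma length_one_hot [simp]: "length (one_hot i n) = n"
  by (simp add: one_hot_def)

lemma nth_one_hot: "k < n \<Longrightarrow> one_hot i n ! k \<longleftrightarrow> k = i"
  by (cases "i < n") (auto simp: one_hot_def nth_list_update)

lemma apply_gate_one_hot:
  assumes "valid_gate n g" "i < n"
  shows "apply_gate g (one_hot i n) = one_hot (move_one g i) n"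
  using assms
  by (cases g)
    (auto intro!: nth_equalityI simp: nth_one_hot nth_list_update transpose_def min_def max_def
      split: if_splits)

lemma apply_network_one_hot:
  "valid_network n C \<Longrightarrow> i < n \<Longrightarrow> apply_network C (one_hot i n) = one_hot (final_channel C i) n"
  by (induction C arbitrary: i) (auto simp: apply_gate_one_hot move_one_less)

lemma final_channel_less: "valid_network n C \<Longrightarrow> p < n \<Longrightarrow> final_channel C p < n"
  by (induction C arbitrary: p) (auto simp: move_one_less)

lemma sorted_one_hot:
  assumes "sorted (one_hot p n)" "p < n"
  shows "p = n - 1"
  using sorted_nth_mono[OF assms(1), of p "n - 1"] assms(2) by (fastforce simp: nth_one_hot)

text \<open>With a one on \<open>i\<close> the comparator acts as an exchange, with a one on
  \<open>j\<close> as the identity; either way it is saved. If the path avoids it, it survives with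
  renumbered channels.\<close>

lemma prune_gate:
  assumes g: "valid_gate n g" and p: "p < n"
  shows "\<exists>D. valid_network (n - 1) D \<and>
    network_size D + (if touches g p then 1 else 0) = (if is_comparator g then 1 else 0) \<and>
    (\<forall>x. length x = n \<longrightarrow> x ! p \<longrightarrow>
      apply_network D (delete_entry x p) = delete_entry (apply_gate g x) (move_one g p))"
proof (cases g)
  case (Exchange i j)
  then show ?thesis using delete_entry_exchange[of i n j p] g p by auto
next
  case (Comparator i j)
  with g have ij: "i < n" "j < n" "i \<noteq> j" by auto
  consider "p = i" | "p = j" | "p \<noteq> i" "p \<noteq> j" by blast
  then show ?thesis
  proof cases
    case 1
    have "apply_gate g x = apply_gate (Exchange i j) x" if "x ! p" for x
      using that 1 Comparator by (simp add: min_def max_def)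
    then show ?thesis
      using delete_entry_exchange[OF ij p] 1 Comparator by auto
  next
    case 2
    have "apply_gate g x = x" if "length x = n" "x ! p" for x
      using that ij 2 Comparator
      by (auto intro!: nth_equalityI simp: nth_list_update min_def max_def split: if_splits)
    then show ?thesis
      using 2 Comparator by (intro exI[of _ "[]"]) auto
  next
    case 3
    let ?D = "[Comparator (remove_channel p i) (remove_channel p j)]"
    have "apply_network ?D (delete_entry x p) = delete_entry (apply_gate g x) p"
      if "length x = n" for x
      using that ij p 3 Comparator by (simp add: delete_entry_update nth_remove_channel)
    then show ?thesis
      using ij p 3 Comparator
      by (intro exI[of _ ?D]) (auto simp: remove_channel_less remove_channel_eq_iff)
  qed
qed

text \<open>Gates are replaced one by one, since by \<open>apply_gate_move_one\<close> the tracked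
  channel still carries a one after each gate.\<close>

lemma prune_network:
  assumes "valid_network n C" "p < n"
  shows "\<exists>D. valid_network (n - 1) D \<and> network_size D + path_comparators C p = network_size C \<and>
    (\<forall>x. length x = n \<longrightarrow> x ! p \<longrightarrow>
      apply_network D (delete_entry x p) = delete_entry (apply_network C x) (final_channel C p))"
  using assms
proof (induction C arbitrary: p)
  case Nil
  show ?case by (intro exI[of _ "[]"]) simp
next
  case (Cons g C)
  from Cons.prems have g: "valid_gate n g" and C: "valid_network n C" by auto
  obtain D where D: "valid_network (n - 1) D"
    "network_size D + (if touches g p then 1 else 0) = (if is_comparator g then 1 else 0)"
    "\<And>x. length x = n \<Longrightarrow> x ! p \<Longrightarrow>
      apply_network D (delete_entry x p) = delete_entry (apply_gate g x) (move_one g p)"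
    using prune_gate[OF g Cons.prems(2)] by blast
  obtain E where E: "valid_network (n - 1) E"
    "network_size E + path_comparators C (move_one g p) = network_size C"
    "\<And>x. length x = n \<Longrightarrow> x ! move_one g p \<Longrightarrow> apply_network E (delete_entry x (move_one g p)) =
      delete_entry (apply_network C x) (final_channel C (move_one g p))"
    using Cons.IH[OF C move_one_less[OF g Cons.prems(2)]] by blast
  have "network_size (D @ E) + path_comparators (g # C) p = network_size (g # C)"
    using D(2) E(2) by simp
  moreover have "apply_network (D @ E) (delete_entry x p) =
      delete_entry (apply_network (g # C) x) (final_channel (g # C) p)"
    if "length x = n" "x ! p" for x
    using that D(3) E(3)[of "apply_gate g x"] g Cons.prems(2) by (simp add: apply_gate_move_one)
  ultimately show ?case
    using D(1) E(1) by (intro exI[of _ "D @ E"]) simp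
qed

lemma path_comparators_le: "path_comparators C p \<le> network_size C"
proof (induction C arbitrary: p)
  case (Cons g C)
  have "touches g p \<Longrightarrow> is_comparator g" by (cases g) auto
  then show ?case using Cons[of "move_one g p"] by auto
qed simp

lemma min_size_prune_le:
  assumes X: "X \<subseteq> seqs n" and C: "partial_sorting_network n X C" and p: "p < n"
  shows "min_size (n - 1) (prune X p) \<le> network_size C - path_comparators C p"
proof -
  from C have "valid_network n C" by (simp add: partial_sorting_network_def)
  from prune_network[OF this p] obtain D where D: "valid_network (n - 1) D"
    "network_size D + path_comparators C p = network_size C"
    "\<And>x. length x = n \<Longrightarrow> x ! p \<Longrightarrow>
      apply_network D (delete_entry x p) = delete_entry (apply_network C x) (final_channel C p)"
    by blast
  \<comment> \<open>The output of \<open>D\<close> is a sorted output of \<open>C\<close> with one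
    entry deleted.\<close>
  have "partial_sorting_network (n - 1) (prune X p) D"
    using X C D(1,3)
    by (auto simp: partial_sorting_network_def prune_def seqs_def subset_iff sorted_delete_entry)
  from min_size_le[OF this] D(2) show ?thesis by simp
qed

text \<open>Kraft's inequality for the binary tree in which the paths ending in channel \<open>q\<close> merge.\<close>

lemma kraft_paths:
  assumes "valid_network n C"
  shows "(\<Sum>p<n. if final_channel C p = q then 2 ^ (network_size C - path_comparators C p) else 0)
    \<le> (2 :: nat) ^ network_size C"
  using assms
proof (induction C)
  case Nil
  show ?case by simp
next
  case (Cons g C)
  \<comment> \<open>The Kraft weight \<open>2 ^ - d\<close> scaled by
    \<open>2 ^ network_size C\<close> to stay in the natural numbers.\<close>
  define w :: "network \<Rightarrow> nat \<Rightarrow> nat" where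
    "w C p = (if final_channel C p = q then 2 ^ (network_size C - path_comparators C p) else 0)"
    for C p
  have IH: "sum (w C) {..<n} \<le> 2 ^ network_size C"
    using Cons by (simp add: w_def)
  have "sum (w (g # C)) {..<n} \<le> 2 ^ network_size (g # C)"
  proof (cases g)
    case (Exchange i j)
    \<comment> \<open>An exchange merely reindexes the starting channels.\<close>
    with Cons.prems have "transpose i j permutes {..<n}"
      by (simp add: permutes_swap_id)
    then have "sum (w C) {..<n} = sum (w C \<circ> transpose i j) {..<n}"
      by (rule sum.permute)
    also have "w C \<circ> transpose i j = w (g # C)"
      using Exchange by (auto simp: w_def)
    finally show ?thesis using IH Exchange by simp
  next
    case (Comparator i j)
    with Cons.prems have ij: "i < n" "j < n" "i \<noteq> j" by auto
    let ?R = "{..<n} - {i, j}"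
    have split: "sum f {..<n} = f i + f j + sum f ?R" for f :: "nat \<Rightarrow> nat"
      using ij by (simp add: sum.subset_diff[of "{i, j}" "{..<n}"])
    \<comment> \<open>The size grows by one but the path gains no comparator;
      \<open>path_comparators_le\<close> keeps the subtraction from truncating.\<close>
    have "w (g # C) p = 2 * w C p" if "p \<in> ?R" for p
      using that Comparator path_comparators_le[of C p] by (auto simp: w_def simp flip: power_Suc)
    then have "sum (w (g # C)) ?R = 2 * sum (w C) ?R"
      by (simp add: sum_distrib_left)
    \<comment> \<open>Both paths continue from \<open>j\<close>, and their extra comparator cancels
      the growth in size. Together they weigh \<open>2 * w C j\<close>, so the doubled sum still
      bounds the total.\<close>
    moreover have "w (g # C) i = w C j" "w (g # C) j = w C j"
      using Comparator ij by (auto simp: w_def)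
    ultimately have "sum (w (g # C)) {..<n} \<le> 2 * sum (w C) {..<n}"
      by (simp add: split)
    then show ?thesis using IH Comparator by (simp add: power_add)
  qed
  then show ?case by (simp add: w_def)
qed


section \<open>The value of the Huffman algorithm\<close>

text \<open>A Huffman step preserves the bound: it turns \<open>2 ^ a + 2 ^ b\<close> with
  \<open>a \<le> b\<close> into \<open>2 ^ b + 2 ^ b\<close>. The last remaining element
  \<open>s\<close> then satisfies \<open>2 ^ s \<le> 2 ^ m\<close>.\<close>

lemma huffman_max_le:
  assumes "L \<noteq> {#}" and "(\<Sum>s\<in>#L. 2 ^ s) \<le> (2 :: nat) ^ m"
  shows "huffman_max L \<le> m"
  using assms
proof (induction L rule: huffman_max.induct)
  case (1 L)
  show ?case
  proof (cases "size L \<le> 1")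
    case True
    with 1(2) have "size L = 1" by (simp add: le_eq_less_or_eq)
    then obtain a where "L = {#a#}" using size_1_singleton_mset by blast
    with 1(3) show ?thesis by (simp add: huffman_max.simps)
  next
    case False
    define a where "a = Min_mset L"
    define L' where "L' = L - {#a#}"
    define b where "b = Min_mset L'"
    define L'' where "L'' = L' - {#b#}"
    have a: "a \<in># L" using 1(2) by (simp add: a_def)
    then have L: "L = add_mset a L'" by (simp add: L'_def)
    with False have "L' \<noteq> {#}" by auto
    then have b: "b \<in># L'" by (simp add: b_def)
    then have L': "L' = add_mset b L''" by (simp add: L''_def)
    have "a \<le> b" unfolding a_def using b L by (intro Min_le) auto
    have "b \<le> s" if "s \<in># L''" for s
      unfolding b_def using that L' by (intro Min_le) auto
    \<comment> \<open>All terms except \<open>2 ^ a\<close> and the bound \<open>2 ^ m\<close> are multiples of \<open>2 ^ b\<close>, so \<open>a\<close> may be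
      rounded up to \<open>b\<close>.\<close>
    then have "2 ^ b dvd (\<Sum>s\<in>#L''. 2 ^ s :: nat)"
      by (induction L'') (auto intro!: dvd_add le_imp_power_dvd)
    then have dvd: "2 ^ b dvd (\<Sum>s\<in>#L'. 2 ^ s :: nat)" by (simp add: L')
    have sum: "2 ^ a + (\<Sum>s\<in>#L'. 2 ^ s) \<le> (2 :: nat) ^ m"
      using 1(3) by (simp add: L)
    then have less: "(\<Sum>s\<in>#L'. 2 ^ s) < (2 :: nat) ^ m"
      using zero_less_power[of "2 :: nat" a] by linarith
    have "2 ^ b \<le> (\<Sum>s\<in>#L'. 2 ^ s :: nat)" by (simp add: L')
    then have "(2 :: nat) ^ b < 2 ^ m" using less by (rule le_less_trans)
    then have "(2 :: nat) ^ b dvd 2 ^ m" by (simp add: le_imp_power_dvd)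
    with dvd have "2 ^ b dvd 2 ^ m - (\<Sum>s\<in>#L'. 2 ^ s :: nat)" by (rule dvd_diff_nat[rotated])
    \<comment> \<open>The gap is positive, as it has room for \<open>2 ^ a\<close>, and a positive
      multiple of \<open>2 ^ b\<close> is at least \<open>2 ^ b\<close>.\<close>
    then have "2 ^ b \<le> 2 ^ m - (\<Sum>s\<in>#L'. 2 ^ s :: nat)"
      using less by (intro dvd_imp_le) auto
    then have "2 ^ b + (\<Sum>s\<in>#L'. 2 ^ s) \<le> (2 :: nat) ^ m" using less by simp
    then have "(\<Sum>s\<in>#add_mset (1 + max a b) L''. 2 ^ s) \<le> (2 :: nat) ^ m"
      using \<open>a \<le> b\<close> by (simp add: L' max_def power_add)
    with 1(1)[OF False a_def L'_def b_def L''_def]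
    have "huffman_max (add_mset (1 + max a b) L'') \<le> m" by simp
    moreover have "huffman_max L = huffman_max (add_mset (1 + max a b) L'')"
      using False by (subst huffman_max.simps) (simp add: Let_def a_def L'_def b_def L''_def)
    ultimately show ?thesis by simp
  qed
qed

section \<open>Combining pruning, Kraft's inequality and the Huffman bound\<close>

theorem mainTheorem3:
  fixes n :: nat and X :: "bool list set"
  assumes "X \<subseteq> seqs n"
    and "prunable_channels n X \<noteq> {}"
  shows "min_size n X \<ge>
    huffman_max {# min_size (n - 1) (prune X i). i \<in># mset_set (prunable_channels n X) #}"
proof -
  let ?P = "prunable_channels n X"
  obtain C where C: "partial_sorting_network n X C" "network_size C = min_size n X"
    using min_size_attained[OF assms(1)] .
  then have valid: "valid_network n C" by (simp add: partial_sorting_network_def)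
  have P: "?P \<subseteq> {..<n}" by (auto simp: prunable_channels_def)
  then have fin: "finite ?P" by (rule finite_subset) simp
  \<comment> \<open>\<open>C\<close> must sort \<open>one_hot i n\<close>, which forces its single
    one onto the last channel.\<close>
  have final: "final_channel C i = n - 1" if "i \<in> ?P" for i
  proof -
    have i: "i < n" "one_hot i n \<in> X" using that by (auto simp: prunable_channels_def)
    with C(1) have "sorted (apply_network C (one_hot i n))"
      by (simp add: partial_sorting_network_def)
    with i valid show ?thesis
      by (simp add: apply_network_one_hot sorted_one_hot final_channel_less)
  qed
  let ?w = "\<lambda>i. if final_channel C i = n - 1
    then 2 ^ (network_size C - path_comparators C i) else (0 :: nat)"
  have "(\<Sum>i\<in>?P. 2 ^ min_size (n - 1) (prune X i)) \<le> sum ?w ?P"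
    using min_size_prune_le[OF assms(1) C(1)] P final
    by (intro sum_mono) (auto intro!: power_increasing)
  \<comment> \<open>Paths from other channels contribute nonnegative weights.\<close>
  also have "\<dots> \<le> sum ?w {..<n}"
    using P by (intro sum_mono2) auto
  also have "\<dots> \<le> 2 ^ network_size C"
    by (rule kraft_paths[OF valid])
  finally have "(\<Sum>s\<in>#{# min_size (n - 1) (prune X i). i \<in># mset_set ?P #}. 2 ^ s)
      \<le> (2 :: nat) ^ min_size n X"
    by (simp add: C(2) sum_unfold_sum_mset image_mset.compositionality comp_def)
  then show ?thesis
    using assms(2) fin by (intro huffman_max_le) (auto simp: mset_set_empty_iff)
qed

end
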